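(* For a building set $\mathcal{B}$ on $[n]$, the $f$-polynomial of the extended nestohedron $\mathcal{P}^{\square}(\mathcal{B})$ satisfies $$f_{\mathcal{P}^{\square}(\mathcal{B})}(t)=\sum_{S\subseteq[n]}(t+1)^{n-|S|}f_{\mathcal{P}(\mathcal{B}|_S)}(t)\quad\text{and}\quad f_{\mathcal{P}^{\square}(\mathcal{B})}(t)=\sum_{S\subseteq[n]}(t+1)^{|(\mathcal{B}|_S)_{\max}|}f_{\mathcal{P}(\mathcal{B}|_S)}(t).$$
   Context: A building set on a finite set $X$ is a collection $\mathcal{B}$ of nonempty subsets of $X$ such that $\{i\}\in\mathcal{B}$ for all $i\in X$, and $I\cup J\in\mathcal{B}$ whenever $I,J\in\mathcal{B}$ with $I\cap J\ne\varnothing$. $\mathcal{B}_{\max}$ is the set of inclusion-maximal elements of $\mathcal{B}$. For $S\subseteq X$, $\mathcal{B}|_S=\{J\in\mathcal{B}:J\subseteq S\}$, a building set on $S$ ($\mathcal{B}|_\varnothing$ is the empty building set on $\varnothing$). A nested collection of $\mathcal{B}$ is a subset $N\subseteq\mathcal{B}\setminus\mathcal{B}_{\max}$ such that any two members are nested or disjoint, and for any $k\ge2$ pairwise disjoint members their union is not in $\mathcal{B}$. An extended nested collection is a set $\{I_1,\dots,I_m,x_{i_1},\dots,x_{i_r}\}$ with $I_j\in\mathcal{B}$ (maximal elements allowed), formal symbols $x_i$ with $i\in X$, such that the $I_j$ are pairwise nested or disjoint, no union of $k\ge2$ pairwise disjoint $I_j$'s lies in $\mathcal{B}$, and no $i_\ell$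 lies in any $I_j$. The nestohedron $\mathcal{P}(\mathcal{B})$ is a simple polytope of dimension $d=|X|-|\mathcal{B}_{\max}|$ whose number $f_i$ of $i$-dimensional faces equals the number of nested collections of cardinality $d-i$ ($0\le i\le d$); the extended nestohedron $\mathcal{P}^{\square}(\mathcal{B})$ is a simple polytope of dimension $|X|$ whose number $f_i$ of $i$-dimensional faces equals the number of extended nested collections of cardinality $|X|-i$. (They are the polar duals of simplicial polytopes whose boundary complexes are the complex of nested collections, resp. extended nested collections.) For the empty building set both are a point. The $f$-polynomial of a $d$-dimensional polytope $P$ is $f_P(t)=\sum_{i=0}^d f_i t^i$. *)

theory Defs
  imports "HOL-Analysis.Analysis" "HOL-Computational_Algebra.Polynomial"
begin

section \<open>Building sets\<close>

definition building_set :: "'v set \<Rightarrow> 'v set set \<Rightarrow> bool" where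
  "building_set X B \<longleftrightarrow>
     finite X \<and> B \<subseteq> Pow X - {{}} \<and> (\<forall>i\<in>X. {i} \<in> B) \<and>
     (\<forall>I\<in>B. \<forall>J\<in>B. I \<inter> J \<noteq> {} \<longrightarrow> I \<union> J \<in> B)"

definition max_elements :: "'v set set \<Rightarrow> 'v set set" where
  "max_elements B = {I \<in> B. \<forall>J\<in>B. I \<subseteq> J \<longrightarrow> J = I}"

definition restrict_building :: "'v set set \<Rightarrow> 'v set \<Rightarrow> 'v set set" where
  "restrict_building B S = {J \<in> B. J \<subseteq> S}"

text \<open>The two conditions on sets common to nested and to extended nested collections. The members
  of a building set on a finite set are nonempty and finitely many, so a subfamily \<open>C\<close> of pairwise
  disjoint members with \<open>card C \<ge> 2\<close> is the same thing as \<open>k \<ge> 2\<close> pairwise disjoint members.\<close>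

definition nested_family :: "'v set set \<Rightarrow> 'v set set \<Rightarrow> bool" where
  "nested_family B N \<longleftrightarrow>
     (\<forall>I\<in>N. \<forall>J\<in>N. I \<subseteq> J \<or> J \<subseteq> I \<or> I \<inter> J = {}) \<and>
     (\<forall>C\<subseteq>N. card C \<ge> 2 \<longrightarrow> pairwise disjnt C \<longrightarrow> \<Union>C \<notin> B)"

definition nested_collections :: "'v set set \<Rightarrow> 'v set set set" where
  "nested_collections B = {N. N \<subseteq> B - max_elements B \<and> nested_family B N}"

text \<open>In an extended nested collection \<open>Inl I\<close> stands for a member \<open>I\<close> of the building set
  and \<open>Inr i\<close> for the formal symbol \<open>x\<^sub>i\<close>.\<close>

definition extended_nested_collections ::
    "'v set \<Rightarrow> 'v set set \<Rightarrow> ('v set + 'v) set set" where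
  "extended_nested_collections X B =
     {M. M \<subseteq> Inl ` B \<union> Inr ` X \<and> nested_family B {I. Inl I \<in> M} \<and>
         (\<forall>i I. Inr i \<in> M \<longrightarrow> Inl I \<in> M \<longrightarrow> i \<notin> I)}"

section \<open>Polytopes\<close>

text \<open>The library counts both the empty set (of affine dimension \<open>-1\<close>) and the polytope itself
  among the faces of a polytope.\<close>

definition simplicial_polytope :: "'a::euclidean_space set \<Rightarrow> bool" where
  "simplicial_polytope Q \<longleftrightarrow>
     polytope Q \<and> (\<forall>F. F face_of Q \<and> F \<noteq> Q \<longrightarrow> (\<exists>k. k simplex F))"

text \<open>The boundary complex, as an abstract simplicial complex: the vertex sets of the
  proper faces.\<close>

definition boundary_complex :: "'a::euclidean_space set \<Rightarrow> 'a set set" where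
  "boundary_complex Q = {{v. v extreme_point_of F} | F. F face_of Q \<and> F \<noteq> Q}"

definition complex_isomorphic :: "'u set set \<Rightarrow> 'w set set \<Rightarrow> bool" where
  "complex_isomorphic K L \<longleftrightarrow> (\<exists>f. inj_on f (\<Union>K) \<and> (\<lambda>\<sigma>. f ` \<sigma>) ` K = L)"

text \<open>Nestohedra are considered up to combinatorial equivalence, so polarity is duality of face
  lattices: \<open>P\<close> is dual to \<open>Q\<close> iff it is combinatorially equivalent to the polar of \<open>Q\<close>.\<close>

definition dual_polytopes :: "'a::euclidean_space set \<Rightarrow> 'b::euclidean_space set \<Rightarrow> bool" where
  "dual_polytopes P Q \<longleftrightarrow> polytope P \<and> polytope Q \<and>
     (\<exists>\<phi>. bij_betw \<phi> {F. F face_of P} {G. G face_of Q} \<and>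
          (\<forall>F F'. F face_of P \<longrightarrow> F' face_of P \<longrightarrow> (F \<subseteq> F' \<longleftrightarrow> \<phi> F' \<subseteq> \<phi> F)))"

text \<open>\<open>P\<close> is a nestohedron, resp. an extended nestohedron, of the building set \<open>B\<close> on \<open>X\<close>. The
  dimensions are stated on the integers, as \<open>aff_dim\<close> is. Such a \<open>P\<close> is simple, being dual to a
  simplicial polytope.\<close>

definition nestohedron :: "'v set \<Rightarrow> 'v set set \<Rightarrow> 'a::euclidean_space set \<Rightarrow> bool" where
  "nestohedron X B P \<longleftrightarrow>
     aff_dim P = int (card X) - int (card (max_elements B)) \<and>
     (\<exists>Q :: 'a set. simplicial_polytope Q \<and> dual_polytopes P Q \<and>
        complex_isomorphic (nested_collections B) (boundary_complex Q))"

definition extended_nestohedron :: "'v set \<Rightarrow> 'v set set \<Rightarrow> 'a::euclidean_space set \<Rightarrow> bool" where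
  "extended_nestohedron X B P \<longleftrightarrow>
     aff_dim P = int (card X) \<and>
     (\<exists>Q :: 'a set. simplicial_polytope Q \<and> dual_polytopes P Q \<and>
        complex_isomorphic (extended_nested_collections X B) (boundary_complex Q))"

definition num_faces :: "'a::euclidean_space set \<Rightarrow> nat \<Rightarrow> nat" where
  "num_faces P i = card {F. F face_of P \<and> aff_dim F = int i}"

definition f_poly :: "'a::euclidean_space set \<Rightarrow> int poly" where
  "f_poly P = (\<Sum>i\<le>nat (aff_dim P). monom (int (num_faces P i)) i)"

end

theory Submission
  imports Defs
begin

text \<open>A face of a simple polytope of dimension \<open>d\<close> that is dual to a simplex with \<open>k\<close> vertices has
  dimension \<open>d - k\<close>, so the f-polynomials are generating functions of (extended) nested collections.
  An extended nested collection is a set of formal symbols, indexed by the complement of some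
  \<open>S\<close>, together with a nested family in \<open>B|\<^sub>S\<close> that may contain maximal elements.
  Splitting off the maximal elements, which can be chosen freely, gives the second formula.
  For the first one, sum over \<open>S\<close> first, with the nested family \<open>N\<close> fixed: \<open>S\<close> ranges over the sets
  containing \<open>\<Union>N\<close>, and \<open>N\<close> is determined by \<open>\<Union>N\<close> and its non-maximal members.\<close>

section \<open>Polytopes dual to simplicial polytopes\<close>

lemma aff_dim_nonneg_iff: "0 \<le> aff_dim S \<longleftrightarrow> S \<noteq> {}" for S :: "'a::euclidean_space set"
  using aff_dim_geq[of S] aff_dim_empty[of S] by linarith

text \<open>Induction on the number of vertices of \<open>\<phi> F\<close>, climbing from
  \<open>F\<close> to a face \<open>F'\<close> directly above it. The dimension rises by one and the
  simplex \<open>\<phi> F\<close> loses exactly one vertex: a larger loss would leave room for a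
  face of the simplex that pulls back to a face strictly between \<open>F\<close> and
  \<open>F'\<close>.\<close>

lemma dual_simplicial_rank:
  fixes P :: "'a::euclidean_space set" and Q :: "'b::euclidean_space set"
  assumes P: "polytope P" and Q: "simplicial_polytope Q"
    and bij: "bij_betw \<phi> {F. F face_of P} {G. G face_of Q}"
    and anti: "\<And>F F'. F face_of P \<Longrightarrow> F' face_of P \<Longrightarrow> F \<subseteq> F' \<longleftrightarrow> \<phi> F' \<subseteq> \<phi> F"
    and "F face_of P" "F \<noteq> {}"
  shows "aff_dim F + int (card {v. v extreme_point_of \<phi> F}) = aff_dim P"
  using assms(5,6)
proof (induction "card {v. v extreme_point_of \<phi> F}" arbitrary: F rule: less_induct)
  case less
  have convP: "convex P" and convQ: "convex Q"
    using P Q by (auto simp: simplicial_polytope_def polytope_imp_convex)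
  have face: "\<phi> T face_of Q" if "T face_of P" for T
    using bij that by (auto simp: bij_betw_def)
  have preimage: "\<exists>T. T face_of P \<and> \<phi> T = G" if "G face_of Q" for G
  proof -
    have "G \<in> \<phi> ` {F. F face_of P}"
      using bij that by (simp add: bij_betw_def)
    then show ?thesis
      by auto
  qed
  have inj: "T = T'" if "T face_of P" "T' face_of P" "\<phi> T = \<phi> T'" for T T'
    using anti[OF that(1,2)] anti[OF that(2,1)] that(3) by auto
  have Pface: "P face_of P" and Qface: "Q face_of Q"
    using convP convQ face_of_refl by auto
  show ?case
  proof (cases "F = P")
    case True
    \<comment> \<open>\<open>P\<close> contains every face, so the order-reversing
      \<open>\<phi>\<close> sends it to the empty face of \<open>Q\<close>, which has no
      vertices.\<close>
    obtain T where "T face_of P" "\<phi> T = {}"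
      using preimage[of "{}"] by auto
    then have "\<phi> P = {}"
      using anti[OF _ Pface] face_of_imp_subset by blast
    then show ?thesis
      using True by simp
  next
    case False
    let ?A = "\<lambda>T. T face_of P \<and> F \<subset> T"
    have "?A P"
      using False Pface face_of_imp_subset[OF less.prems(1)] by auto
    \<comment> \<open>Least dimension ensures that no face lies strictly between \<open>F\<close>
      and \<open>F'\<close>. Taking \<open>nat\<close> loses nothing, because faces containing the
      nonempty \<open>F\<close> have nonnegative dimension.\<close>
    then obtain F' where F': "?A F'"
      and least: "\<And>T. ?A T \<Longrightarrow> nat (aff_dim F') \<le> nat (aff_dim T)"
      using ex_has_least_nat[of ?A P "\<lambda>T. nat (aff_dim T)"] by blast
    have F'convex: "convex F'"
      using F' convP face_of_imp_convex by blast
    have minimal: "T = F" if T: "T face_of F'" "F \<subseteq> T" "T \<noteq> F'" for T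
    proof (rule ccontr)
      assume "T \<noteq> F"
      then have "?A T"
        using T F' face_of_trans by blast
      then have "nat (aff_dim F') \<le> nat (aff_dim T)"
        using least by blast
      moreover have "aff_dim T < aff_dim F'"
        using face_of_aff_dim_lt[OF F'convex T(1,3)] .
      moreover have "0 \<le> aff_dim T"
        using T(2) less.prems(2) aff_dim_nonneg_iff[of T] by auto
      ultimately show False
        by linarith
    qed
    have FF': "F face_of F'"
      using F' less.prems(1) face_of_face by blast
    have "polyhedron F'"
      using F' P face_of_polytope_polytope polytope_imp_polyhedron by blast
    \<comment> \<open>The proper face \<open>F\<close> lies in some facet of \<open>F'\<close>, and
      minimality forces that facet to be \<open>F\<close>.\<close>
    then obtain T where T: "T facet_of F'" "F \<subseteq> T"
      using face_of_polyhedron_subset_facet FF' F' less.prems(2) by blast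
    then have "T face_of F'" "T \<noteq> F'"
      by (auto simp: facet_of_def)
    then have "F facet_of F'"
      using minimal T by blast
    then have dimF: "aff_dim F = aff_dim F' - 1"
      by (simp add: facet_of_def)
    \<comment> \<open>Only the empty face of \<open>P\<close> can correspond to \<open>Q\<close>.
      Hence \<open>\<phi> F\<close> is a proper face and therefore a simplex, with vertex set
      \<open>C\<close> below.\<close>
    have "\<phi> F \<noteq> Q"
    proof
      assume eq: "\<phi> F = Q"
      have "\<phi> {} \<subseteq> \<phi> F"
        using face[of "{}"] eq face_of_imp_subset by auto
      then show False
        using anti[OF less.prems(1), of "{}"] less.prems(2) by auto
    qed
    then obtain C where C: "\<not> affine_dependent C" "\<phi> F = convex hull C"
      using Q face[OF less.prems(1)] unfolding simplicial_polytope_def simplex_def by metis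
    have "\<phi> F' face_of \<phi> F"
      using face F' less.prems(1) anti[of F F'] face_of_face[of "\<phi> F" Q] by blast
    then obtain c where c: "c \<subseteq> C" "\<phi> F' = convex hull c"
      using C face_of_convex_hull_affine_independent by metis
    have vert: "{v. v extreme_point_of (convex hull s)} = s" if "s \<subseteq> C" for s
      using that C(1) affine_independent_subset extreme_point_of_convex_hull_affine_independent
      by blast
    have "c \<noteq> C"
      using inj[of F F'] F' less.prems(1) c(2) C(2) by auto
    \<comment> \<open>Adding a single missing vertex to \<open>c\<close> gives a face of the simplex
      \<open>\<phi> F\<close> strictly larger than \<open>\<phi> F'\<close>. Its preimage
      \<open>F1\<close> lies between \<open>F\<close> and \<open>F'\<close>, so it is
      \<open>F\<close>, and \<open>insert v c\<close> is already all of \<open>C\<close>.\<close>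
    then obtain v where v: "v \<in> C" "v \<notin> c"
      using c(1) by blast
    let ?H = "convex hull (insert v c)"
    have "?H face_of \<phi> F"
      unfolding C(2) face_of_convex_hull_affine_independent[OF C(1)] using v c by blast
    then have HQ: "?H face_of Q" and HF: "?H \<subseteq> \<phi> F"
      using face less.prems(1) face_of_trans face_of_imp_subset by blast+
    obtain F1 where F1: "F1 face_of P" "\<phi> F1 = ?H"
      using preimage[OF HQ] by blast
    have "F1 \<subseteq> F'"
      using anti[of F1 F'] F1 F' c(2) hull_mono[of c "insert v c" convex] by blast
    then have F1': "F1 face_of F'"
      using F1 F' face_of_face by blast
    have "F \<subseteq> F1"
      using anti[of F F1] F1 less.prems(1) HF by blast
    have vert_c: "{u. u extreme_point_of (convex hull c)} = c"
      and vert_H: "{u. u extreme_point_of ?H} = insert v c"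
      and vert_C: "{u. u extreme_point_of (convex hull C)} = C"
      using c(1) v(1) by (auto intro!: vert simp del: mem_Collect_eq)
    have "F1 \<noteq> F'"
    proof
      assume "F1 = F'"
      then have "?H = convex hull c"
        using F1(2) c(2) by simp
      then have "insert v c = c"
        using vert_c vert_H by simp
      then show False
        using v(2) by blast
    qed
    then have "F1 = F"
      using minimal F1' \<open>F \<subseteq> F1\<close> by blast
    then have "?H = convex hull C"
      using F1(2) C(2) by simp
    then have "insert v c = C"
      using vert_C vert_H by simp
    then have card: "card {v. v extreme_point_of \<phi> F} = Suc (card {v. v extreme_point_of \<phi> F'})"
      unfolding C(2) c(2) vert_c vert_C
      using v(2) aff_independent_finite[OF C(1)] by auto
    then have "aff_dim F' + int (card {v. v extreme_point_of \<phi> F'}) = aff_dim P"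
      using less.hyps[of F'] F' by auto
    then show ?thesis
      using card dimF by simp
  qed
qed

section \<open>f-polynomials as sums over faces and over dual complexes\<close>

text \<open>Group the faces by dimension. The empty face has to be left out: \<open>nat\<close>
  would turn its dimension -1 into 0 and count it as a vertex.\<close>

lemma f_poly_sum_faces:
  fixes P :: "'a::euclidean_space set"
  assumes "polytope P"
  shows "f_poly P = (\<Sum>F | F face_of P \<and> F \<noteq> {}. [:0, 1:] ^ nat (aff_dim F))"
proof -
  let ?\<F> = "{F. F face_of P \<and> F \<noteq> {}}"
  have fin: "finite ?\<F>"
    by (rule finite_subset[OF _ finite_polytope_faces[OF assms]]) auto
  have "(\<Sum>F\<in>?\<F>. [:0, 1::int:] ^ nat (aff_dim F)) =
      (\<Sum>i\<le>nat (aff_dim P). \<Sum>F | F \<in> ?\<F> \<and> nat (aff_dim F) = i. [:0, 1:] ^ nat (aff_dim F))"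
    using aff_dim_subset face_of_imp_subset
    by (intro sum.group[symmetric] fin) (auto intro!: nat_mono)
  also have "\<dots> = f_poly P"
    unfolding f_poly_def
  proof (rule sum.cong[OF refl])
    fix i
    have "{F \<in> ?\<F>. nat (aff_dim F) = i} = {F. F face_of P \<and> aff_dim F = int i}"
      using aff_dim_nonneg_iff by (auto simp: nat_eq_iff)
    then have "(\<Sum>F | F \<in> ?\<F> \<and> nat (aff_dim F) = i. [:0, 1::int:] ^ nat (aff_dim F)) =
        (\<Sum>F | F face_of P \<and> aff_dim F = int i. monom 1 i)"
      by (intro sum.cong) (auto simp: monom_altdef)
    then show "(\<Sum>F | F \<in> ?\<F> \<and> nat (aff_dim F) = i. [:0, 1::int:] ^ nat (aff_dim F)) =
        monom (int (num_faces P i)) i"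
      by (simp add: num_faces_def of_nat_monom mult_monom)
  qed
  finally show ?thesis ..
qed

text \<open>The sum is carried along bijections from the nonempty faces of \<open>P\<close> to the
  proper faces of \<open>Q\<close>, then to their vertex sets, then to \<open>K\<close>;
  \<open>dual_simplicial_rank\<close> supplies the exponent. The empty simplex stands for
  \<open>P\<close> itself.\<close>

lemma f_poly_dual_simplicial:
  fixes P :: "'a::euclidean_space set" and Q :: "'b::euclidean_space set"
  assumes Q: "simplicial_polytope Q" and dual: "dual_polytopes P Q"
    and iso: "complex_isomorphic K (boundary_complex Q)"
  shows "f_poly P = (\<Sum>\<sigma>\<in>K. [:0, 1:] ^ (nat (aff_dim P) - card \<sigma>))"
proof -
  obtain \<phi> where P: "polytope P" and polQ: "polytope Q"
    and bij: "bij_betw \<phi> {F. F face_of P} {G. G face_of Q}"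
    and anti: "\<And>F F'. F face_of P \<Longrightarrow> F' face_of P \<Longrightarrow> F \<subseteq> F' \<longleftrightarrow> \<phi> F' \<subseteq> \<phi> F"
    using dual unfolding dual_polytopes_def by blast
  define vert where "vert G = {v. v extreme_point_of G}" for G :: "'b set"
  have Qface: "Q face_of Q"
    using polQ face_of_refl polytope_imp_convex by blast
  \<comment> \<open>The smallest face of \<open>P\<close> corresponds to the largest face of
    \<open>Q\<close>, so discarding the empty face on one side discards \<open>Q\<close> on the
    other.\<close>
  have top: "\<phi> {} = Q"
  proof -
    have "Q \<in> \<phi> ` {F. F face_of P}"
      using bij Qface by (simp add: bij_betw_def)
    then obtain T where T: "T face_of P" "\<phi> T = Q"
      by auto
    then have "Q \<subseteq> \<phi> {}"
      using anti[of "{}" T] by auto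
    moreover have "\<phi> {} face_of Q"
      using bij by (auto simp: bij_betw_def)
    ultimately show ?thesis
      using face_of_imp_subset by blast
  qed
  have "bij_betw \<phi> ({F. F face_of P} - {{}}) ({G. G face_of Q} - {Q})"
    using bij_betw_DiffI[OF bij, of "{{}}" "{Q}"] top Qface by (auto simp: bij_betw_def)
  moreover have "{F. F face_of P} - {{}} = {F. F face_of P \<and> F \<noteq> {}}"
    "{G. G face_of Q} - {Q} = {G. G face_of Q \<and> G \<noteq> Q}"
    by auto
  ultimately have bij': "bij_betw \<phi> {F. F face_of P \<and> F \<noteq> {}} {G. G face_of Q \<and> G \<noteq> Q}"
    by simp
  \<comment> \<open>By Krein-Milman a face is determined by its vertices, which makes
    \<open>vert\<close> injective on faces.\<close>
  have hull: "G = convex hull vert G" if "G face_of Q" for G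
    unfolding vert_def
    using that polQ face_of_polytope_polytope polytope_imp_compact polytope_imp_convex
      Krein_Milman_Minkowski by blast
  have "boundary_complex Q = vert ` {G. G face_of Q \<and> G \<noteq> Q}"
    unfolding boundary_complex_def vert_def by auto
  moreover have "inj_on vert {G. G face_of Q \<and> G \<noteq> Q}"
  proof (rule inj_onI)
    fix G H assume "G \<in> {G. G face_of Q \<and> G \<noteq> Q}" "H \<in> {G. G face_of Q \<and> G \<noteq> Q}"
      "vert G = vert H"
    then show "G = H"
      using hull[of G] hull[of H] by simp
  qed
  ultimately have bij_vert: "bij_betw vert {G. G face_of Q \<and> G \<noteq> Q} (boundary_complex Q)"
    by (simp add: bij_betw_def)
  obtain f where f: "inj_on f (\<Union>K)" "(\<lambda>\<sigma>. f ` \<sigma>) ` K = boundary_complex Q"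
    using iso unfolding complex_isomorphic_def by blast
  have "inj_on (\<lambda>\<sigma>. f ` \<sigma>) K"
    using f(1) by (auto intro!: inj_onI dest: inj_on_image_eq_iff[OF f(1), THEN iffD1, rotated 2])
  then have bij_K: "bij_betw (\<lambda>\<sigma>. f ` \<sigma>) K (boundary_complex Q)"
    using f(2) by (simp add: bij_betw_def)
  have card_f: "card (f ` \<sigma>) = card \<sigma>" if "\<sigma> \<in> K" for \<sigma>
    using that f(1) by (meson Union_upper card_image inj_on_subset)
  have "f_poly P = (\<Sum>F | F face_of P \<and> F \<noteq> {}. [:0, 1:] ^ nat (aff_dim F))"
    using f_poly_sum_faces[OF P] .
  also have "\<dots> = (\<Sum>F | F face_of P \<and> F \<noteq> {}. [:0, 1:] ^ (nat (aff_dim P) - card (vert (\<phi> F))))"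
  proof (rule sum.cong[OF refl])
    fix F assume "F \<in> {F. F face_of P \<and> F \<noteq> {}}"
    then have "aff_dim F + int (card (vert (\<phi> F))) = aff_dim P"
      using dual_simplicial_rank[OF P Q bij anti, of F] unfolding vert_def by blast
    then have "nat (aff_dim F) = nat (aff_dim P) - card (vert (\<phi> F))"
      by linarith
    then show "[:0, 1::int:] ^ nat (aff_dim F) = [:0, 1:] ^ (nat (aff_dim P) - card (vert (\<phi> F)))"
      by simp
  qed
  also have "\<dots> = (\<Sum>G | G face_of Q \<and> G \<noteq> Q. [:0, 1:] ^ (nat (aff_dim P) - card (vert G)))"
    by (rule sum.reindex_bij_betw[OF bij'])
  also have "\<dots> = (\<Sum>\<tau>\<in>boundary_complex Q. [:0, 1:] ^ (nat (aff_dim P) - card \<tau>))"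
    by (rule sum.reindex_bij_betw[OF bij_vert])
  also have "\<dots> = (\<Sum>\<sigma>\<in>K. [:0, 1:] ^ (nat (aff_dim P) - card (f ` \<sigma>)))"
    by (rule sum.reindex_bij_betw[OF bij_K, symmetric])
  also have "\<dots> = (\<Sum>\<sigma>\<in>K. [:0, 1:] ^ (nat (aff_dim P) - card \<sigma>))"
    by (rule sum.cong[OF refl]) (simp add: card_f)
  finally show ?thesis .
qed

section \<open>Nested families\<close>

lemma building_setD:
  assumes "building_set X B"
  shows "finite X" "finite B" "\<And>I. I \<in> B \<Longrightarrow> I \<noteq> {} \<and> I \<subseteq> X"
    "\<And>i. i \<in> X \<Longrightarrow> {i} \<in> B" "\<And>I J. I \<in> B \<Longrightarrow> J \<in> B \<Longrightarrow> I \<inter> J \<noteq> {} \<Longrightarrow> I \<union> J \<in> B"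
  using assms unfolding building_set_def by (auto intro: finite_subset[of B "Pow X"])

lemma building_set_restrict:
  assumes "building_set X B" "S \<subseteq> X"
  shows "building_set S (restrict_building B S)"
  using assms unfolding building_set_def restrict_building_def
  by (auto intro: finite_subset)

lemma max_elements_disjoint:
  assumes "building_set X B" "K \<in> max_elements B" "J \<in> B"
  shows "J \<subseteq> K \<or> J \<inter> K = {}"
proof (rule ccontr)
  assume "\<not> ?thesis"
  then have "K \<union> J \<in> B" "\<not> J \<subseteq> K"
    using building_setD(5)[OF assms(1), of K J] assms by (auto simp: max_elements_def)
  then show False
    using assms(2) unfolding max_elements_def by blast
qed

lemma ex_max_element:
  assumes "finite B" "I \<in> B"
  shows "\<exists>K\<in>max_elements B. I \<subseteq> K"
proof -
  obtain K where K: "K \<in> B" "I \<subseteq> K" "\<forall>J\<in>B. K \<subseteq> J \<longrightarrow> K = J"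
    using finite_has_maximal2[OF assms] by blast
  then have "K \<in> max_elements B"
    by (auto simp: max_elements_def)
  then show ?thesis
    using K(2) by blast
qed

lemma Union_max_elements:
  assumes "finite B"
  shows "\<Union>(max_elements B) = \<Union>B"
proof
  show "\<Union>(max_elements B) \<subseteq> \<Union>B"
    by (auto simp: max_elements_def)
  show "\<Union>B \<subseteq> \<Union>(max_elements B)"
    using ex_max_element[OF assms] by blast
qed

lemma Union_building_set: "building_set X B \<Longrightarrow> \<Union>B = X"
  unfolding building_set_def by auto

text \<open>Members of \<open>C\<close> are absorbed one at a time; each meets the union built so
  far because it meets \<open>K\<close>.\<close>

lemma building_set_Union_meeting:
  assumes B: "building_set X B" and K: "K \<in> B" and "finite C"
    and "C \<subseteq> B" "\<And>J. J \<in> C \<Longrightarrow> J \<inter> K \<noteq> {}"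
  shows "K \<union> \<Union>C \<in> B"
  using assms(3-5)
proof (induction C)
  case (insert J C)
  then have "K \<union> \<Union>C \<in> B" "J \<in> B" "(K \<union> \<Union>C) \<inter> J \<noteq> {}"
    by auto
  then have "(K \<union> \<Union>C) \<union> J \<in> B"
    by (rule building_setD(5)[OF B])
  then show ?case
    by (simp add: Un_ac)
qed (simp add: K)

section \<open>Nested families and bounds on their size\<close>

text \<open>Nested collections with maximal elements allowed: the part of an extended nested
  collection that consists of sets.\<close>

definition nested_families :: "'v set set \<Rightarrow> 'v set set set" where
  "nested_families B = {N. N \<subseteq> B \<and> nested_family B N}"

lemma finite_nested_families: "finite B \<Longrightarrow> finite (nested_families B)"
  unfolding nested_families_def by (rule finite_subset[of _ "Pow B"]) auto

lemma finite_nested_collections: "finite B \<Longrightarrow> finite (nested_collections B)"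
  unfolding nested_collections_def by (rule finite_subset[of _ "Pow B"]) auto

lemma nested_family_subset: "nested_family B N \<Longrightarrow> N' \<subseteq> N \<Longrightarrow> nested_family B N'"
  unfolding nested_family_def by (meson order_trans subsetD)

text \<open>The inclusion-maximal members of \<open>N'\<close> are pairwise disjoint and have the
  same union as \<open>N'\<close>. Two or more of them cannot have a union in \<open>B\<close>, so
  there is just one, and it is the union.\<close>

lemma nested_family_Union_mem:
  assumes B: "building_set X B" and N: "N \<in> nested_families B"
    and "N' \<subseteq> N" and U: "\<Union>N' \<in> B"
  shows "\<Union>N' \<in> N'"
proof -
  let ?C = "max_elements N'"
  have N': "N' \<subseteq> B" "nested_family B N'"
    using N assms(3) nested_family_subset unfolding nested_families_def by blast+
  then have fin: "finite N'"
    using building_setD(2)[OF B] finite_subset by blast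
  have C: "?C \<subseteq> N'"
    by (auto simp: max_elements_def)
  have "pairwise disjnt ?C"
    unfolding pairwise_def disjnt_def
  proof (intro ballI impI)
    fix I J assume IJ: "I \<in> ?C" "J \<in> ?C" "I \<noteq> J"
    then have "I \<subseteq> J \<or> J \<subseteq> I \<or> I \<inter> J = {}"
      using N'(2) C unfolding nested_family_def by blast
    then show "I \<inter> J = {}"
      using IJ unfolding max_elements_def by blast
  qed
  moreover have UC: "\<Union>?C = \<Union>N'"
    using Union_max_elements[OF fin] .
  ultimately have "\<not> card ?C \<ge> 2"
    using N'(2) C U unfolding nested_family_def by metis
  \<comment> \<open>Without maximal members the union would be empty, but members of
    \<open>B\<close> are nonempty.\<close>
  moreover have "card ?C \<noteq> 0"
    using fin C finite_subset UC U building_setD(3)[OF B] by fastforce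
  ultimately have "card ?C = 1"
    by linarith
  then obtain J where "?C = {J}"
    by (auto simp: card_1_singleton_iff)
  then show ?thesis
    using UC C by auto
qed

text \<open>Every member of a nested family has a point lying in no smaller member; choosing such points
  injects the family into its union.\<close>

lemma card_nested_family_le:
  assumes B: "building_set X B" and N: "N \<in> nested_families B"
  shows "card N \<le> card (\<Union>N)"
proof -
  have NB: "N \<subseteq> B"
    using N by (auto simp: nested_families_def)
  have "\<exists>x\<in>I. \<forall>J\<in>N. J \<subset> I \<longrightarrow> x \<notin> J" if I: "I \<in> N" for I
  proof (rule ccontr)
    assume "\<not> ?thesis"
    \<comment> \<open>If no point is left over, \<open>I\<close> is the union of its proper subsets
      in \<open>N\<close>, and \<open>nested_family_Union_mem\<close> makes \<open>I\<close> one of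
      them.\<close>
    then have eq: "\<Union>{J \<in> N. J \<subset> I} = I"
      by blast
    then have "I \<in> {J \<in> N. J \<subset> I}"
      using nested_family_Union_mem[OF B N, of "{J \<in> N. J \<subset> I}"] I NB by auto
    then show False
      by simp
  qed
  then obtain p where p: "\<And>I. I \<in> N \<Longrightarrow> p I \<in> I \<and> (\<forall>J\<in>N. J \<subset> I \<longrightarrow> p I \<notin> J)"
    by metis
  have "inj_on p N"
  proof (rule inj_onI)
    fix I J assume IJ: "I \<in> N" "J \<in> N" "p I = p J"
    then have "p I \<in> I \<inter> J"
      using p by force
    then have "I \<subseteq> J \<or> J \<subseteq> I"
      using N IJ unfolding nested_families_def nested_family_def by blast
    \<comment> \<open>If one set were strictly smaller, it would contain the chosen point of the
      larger one.\<close>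
    then show "I = J"
      using p[OF IJ(1)] p[OF IJ(2)] IJ by auto
  qed
  moreover have "finite (\<Union>N)"
    using NB building_setD(1,3)[OF B] by (meson Sup_least finite_subset subsetD)
  moreover have "p ` N \<subseteq> \<Union>N"
    using p by blast
  ultimately show ?thesis
    using card_inj_on_le by blast
qed

text \<open>A member of \<open>B\<close> lies inside a given maximal element or is disjoint from it.
  A disjoint subfamily that contains a maximal \<open>K\<close> and has its union in
  \<open>B\<close> must have union \<open>K\<close>, which leaves no room for a second nonempty
  member.\<close>

lemma nested_collection_Un_max:
  assumes B: "building_set X B" and N: "N \<in> nested_collections B" and A: "A \<subseteq> max_elements B"
  shows "N \<union> A \<in> nested_families B"
proof -
  have NB: "N \<subseteq> B" "nested_family B N" and AB: "A \<subseteq> B"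
    using N A by (auto simp: nested_collections_def max_elements_def)
  have "I \<subseteq> J \<or> J \<subseteq> I \<or> I \<inter> J = {}" if IJ: "I \<in> N \<union> A" "J \<in> N \<union> A" for I J
  proof (cases "I \<in> A \<or> J \<in> A")
    case True
    then show ?thesis
      using max_elements_disjoint[OF B, of I J] max_elements_disjoint[OF B, of J I] A IJ NB(1) AB
      by blast
  next
    case False
    then show ?thesis
      using IJ NB(2) unfolding nested_family_def by blast
  qed
  moreover have "\<Union>C \<notin> B" if C: "C \<subseteq> N \<union> A" "card C \<ge> 2" "pairwise disjnt C" for C
  proof
    assume U: "\<Union>C \<in> B"
    then have "\<not> C \<subseteq> N"
      using NB(2) C unfolding nested_family_def by blast
    then obtain K where K: "K \<in> C" "K \<in> max_elements B"
      using C(1) A by blast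
    then have eq: "\<Union>C = K"
      using U unfolding max_elements_def by blast
    have "C \<noteq> {K}"
      using C(2) by auto
    then obtain J where J: "J \<in> C" "J \<noteq> K"
      using K(1) by blast
    then have "J \<inter> K = {}" "J \<subseteq> K"
      using C(3) K(1) eq unfolding pairwise_def disjnt_def by auto
    moreover have "J \<noteq> {}"
      using building_setD(3)[OF B, of J] J(1) C(1) NB(1) AB by blast
    ultimately show False
      by blast
  qed
  ultimately show ?thesis
    using NB(1) AB unfolding nested_families_def nested_family_def by blast
qed

text \<open>Apply the point-choosing bound after adjoining all maximal elements. This keeps the
  exponents in the f-polynomial of the nestohedron from being truncated.\<close>

lemma card_nested_collection_le:
  assumes B: "building_set X B" and N: "N \<in> nested_collections B"
  shows "card N + card (max_elements B) \<le> card X"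
proof -
  have sub: "N \<subseteq> B - max_elements B" "max_elements B \<subseteq> B"
    using N by (auto simp: nested_collections_def max_elements_def)
  then have "card N + card (max_elements B) = card (N \<union> max_elements B)"
    using building_setD(2)[OF B] by (intro card_Un_disjoint[symmetric]) (auto intro: finite_subset)
  also have "\<dots> \<le> card (\<Union>(N \<union> max_elements B))"
    using card_nested_family_le[OF B nested_collection_Un_max[OF B N order_refl]] .
  also have "\<dots> \<le> card X"
    using sub Union_building_set[OF B] building_setD(1)[OF B] by (intro card_mono) auto
  finally show ?thesis .
qed

section \<open>Generating functions of nested families\<close>

text \<open>Expand the product of \<open>1 + x\<close> over \<open>D\<close>; the set
  \<open>A\<close> records the factors that contribute 1.\<close>

lemma sum_Pow_power:
  fixes x :: "'c::comm_semiring_1"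
  assumes "finite D"
  shows "(\<Sum>A\<in>Pow D. x ^ (card D - card A)) = (x + 1) ^ card D"
proof -
  have "(x + 1) ^ card D = (\<Prod>d\<in>D. 1 + x)"
    by (simp add: add.commute)
  also have "\<dots> = (\<Sum>A\<in>Pow D. (\<Prod>d\<in>A. 1) * (\<Prod>d\<in>D - A. x))"
    using prod_add[OF assms] .
  also have "\<dots> = (\<Sum>A\<in>Pow D. x ^ (card D - card A))"
    by (intro sum.cong) (auto simp: card_Diff_subset finite_subset[OF _ assms])
  finally show ?thesis ..
qed

lemma sum_nested_families:
  fixes x :: "'c::comm_semiring_1"
  assumes B: "building_set X B"
  shows "(\<Sum>N\<in>nested_families B. x ^ (card X - card N)) =
    (x + 1) ^ card (max_elements B) *
    (\<Sum>N\<in>nested_collections B. x ^ (card X - card (max_elements B) - card N))"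
proof -
  let ?M = "max_elements B"
  have M: "?M \<subseteq> B"
    by (auto simp: max_elements_def)
  have fin: "finite B" "finite ?M"
    using building_setD(2)[OF B] M finite_subset by auto
  have NB: "N \<subseteq> B - ?M" if "N \<in> nested_collections B" for N
    using that by (simp add: nested_collections_def)
  have "(\<Sum>(A, N)\<in>Pow ?M \<times> nested_collections B.
        x ^ (card ?M - card A) * x ^ (card X - card ?M - card N)) =
      (\<Sum>N\<in>nested_families B. x ^ (card X - card N))"
  proof (rule sum.reindex_bij_witness[where i = "\<lambda>N. (N \<inter> ?M, N - ?M)" and j = "\<lambda>(A, N). A \<union> N"])
    fix AN assume "AN \<in> Pow ?M \<times> nested_collections B"
    then obtain A N where AN: "AN = (A, N)" "A \<subseteq> ?M" "N \<in> nested_collections B"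
      by auto
    show "((case AN of (A, N) \<Rightarrow> A \<union> N) \<inter> ?M, (case AN of (A, N) \<Rightarrow> A \<union> N) - ?M) = AN"
      using AN NB by auto
    show "(case AN of (A, N) \<Rightarrow> A \<union> N) \<in> nested_families B"
      using nested_collection_Un_max[OF B AN(3,2)] AN(1) by (simp add: Un_commute)
    have "card (A \<union> N) = card A + card N"
      using AN NB[OF AN(3)] fin by (intro card_Un_disjoint) (auto intro: finite_subset)
    moreover have "card A \<le> card ?M"
      using AN(2) fin(2) card_mono by blast
    \<comment> \<open>Neither difference on the right is truncated, so the power splits into a
      factor for \<open>A\<close> and a factor for \<open>N\<close>.\<close>
    ultimately have "card X - card (A \<union> N) = (card ?M - card A) + (card X - card ?M - card N)"
      using card_nested_collection_le[OF B AN(3)] by linarith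
    then show "x ^ (card X - card (case AN of (A, N) \<Rightarrow> A \<union> N)) =
        (case AN of (A, N) \<Rightarrow> x ^ (card ?M - card A) * x ^ (card X - card ?M - card N))"
      using AN(1) by (simp add: power_add)
  next
    fix N assume "N \<in> nested_families B"
    then have "N \<subseteq> B" "nested_family B (N - ?M)"
      using nested_family_subset[of B N "N - ?M"] by (auto simp: nested_families_def)
    then show "(N \<inter> ?M, N - ?M) \<in> Pow ?M \<times> nested_collections B"
      by (auto simp: nested_collections_def)
  qed auto
  then show ?thesis
    unfolding sum_Pow_power[OF fin(2), symmetric] sum_product sum.cartesian_product
    by simp
qed

text \<open>Unions of subfamilies of \<open>N\<close> stay inside \<open>S\<close>, where membership
  in \<open>B\<close> and in its restriction agree.\<close>

lemma nested_families_restrict: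
  "nested_families (restrict_building B S) = {N \<in> nested_families B. \<Union>N \<subseteq> S}"
proof -
  have "nested_family (restrict_building B S) N \<longleftrightarrow> nested_family B N" if "\<Union>N \<subseteq> S" for N
  proof -
    have "\<Union>C \<subseteq> S" if "C \<subseteq> N" for C
      using that \<open>\<Union>N \<subseteq> S\<close> by blast
    then show ?thesis
      unfolding nested_family_def restrict_building_def by auto
  qed
  moreover have "N \<subseteq> restrict_building B S \<longleftrightarrow> N \<subseteq> B \<and> \<Union>N \<subseteq> S" for N
    unfolding restrict_building_def by blast
  ultimately show ?thesis
    by (auto simp: nested_families_def)
qed

text \<open>Let \<open>X - S\<close> be the indices of the formal symbols. The condition that no
  index lies in a chosen set then says that the union of the sets is contained in \<open>S\<close>,
  and the \<open>card (X - S)\<close> symbols lower the exponent base from \<open>card X\<close> to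
  \<open>card S\<close>.\<close>

lemma sum_extended_nested_collections:
  fixes x :: "'c::comm_semiring_1"
  assumes B: "building_set X B"
  shows "(\<Sum>M\<in>extended_nested_collections X B. x ^ (card X - card M)) =
    (\<Sum>S\<in>Pow X. \<Sum>N\<in>nested_families (restrict_building B S). x ^ (card S - card N))"
proof -
  have finX: "finite X" and finB: "finite B"
    using building_setD[OF B] by auto
  let ?\<S> = "SIGMA S:Pow X. nested_families (restrict_building B S)"
  have finF: "finite (nested_families (restrict_building B S))" for S
    using finB by (intro finite_nested_families) (simp add: restrict_building_def)
  have "(\<Sum>(S, N)\<in>?\<S>. x ^ (card S - card N)) =
      (\<Sum>M\<in>extended_nested_collections X B. x ^ (card X - card M))"
  proof (rule sum.reindex_bij_witness[where i = "\<lambda>M. (X - {i. Inr i \<in> M}, {I. Inl I \<in> M})"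
        and j = "\<lambda>(S, N). Inl ` N \<union> Inr ` (X - S)"])
    fix SN assume "SN \<in> ?\<S>"
    then obtain S N where SN: "SN = (S, N)" "S \<subseteq> X" "N \<in> nested_families B" "\<Union>N \<subseteq> S"
      unfolding nested_families_restrict by auto
    let ?M = "Inl ` N \<union> Inr ` (X - S)"
    have N: "{I. Inl I \<in> ?M} = N" and S: "X - {i. Inr i \<in> ?M} = S"
      using SN(2) by auto
    show "(X - {i. Inr i \<in> (case SN of (S, N) \<Rightarrow> Inl ` N \<union> Inr ` (X - S))},
        {I. Inl I \<in> (case SN of (S, N) \<Rightarrow> Inl ` N \<union> Inr ` (X - S))}) = SN"
      using SN(1) N S by simp
    show "(case SN of (S, N) \<Rightarrow> Inl ` N \<union> Inr ` (X - S)) \<in> extended_nested_collections X B"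
      using SN N unfolding extended_nested_collections_def nested_families_def by auto
    have "finite N"
      using SN(3) finB finite_subset by (auto simp: nested_families_def)
    then have "card ?M = card N + card (X - S)"
      using finX by (subst card_Un_disjoint) (auto simp: card_image)
    then have "card X - card ?M = card S - card N"
      using SN(2) finX card_mono[OF finX SN(2)] by (simp add: card_Diff_subset finite_subset)
    then show "x ^ (card X - card (case SN of (S, N) \<Rightarrow> Inl ` N \<union> Inr ` (X - S))) =
        (case SN of (S, N) \<Rightarrow> x ^ (card S - card N))"
      using SN(1) by simp
  next
    fix M assume M: "M \<in> extended_nested_collections X B"
    have "M \<subseteq> Inl ` B \<union> Inr ` X"
      using M by (simp add: extended_nested_collections_def)
    then have MX: "m \<in> Inl ` B \<union> Inr ` X" if "m \<in> M" for m
      using that by blast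
    show "(case (X - {i. Inr i \<in> M}, {I. Inl I \<in> M}) of (S, N) \<Rightarrow> Inl ` N \<union> Inr ` (X - S)) = M"
    proof (rule set_eqI)
      fix m
      show "m \<in> (case (X - {i. Inr i \<in> M}, {I. Inl I \<in> M}) of
          (S, N) \<Rightarrow> Inl ` N \<union> Inr ` (X - S)) \<longleftrightarrow> m \<in> M"
        using MX[of m] by (cases m) auto
    qed
    have IB: "I \<in> B" if "Inl I \<in> M" for I
      using MX[OF that] by auto
    have "{I. Inl I \<in> M} \<in> nested_families B"
      using M IB by (auto simp: extended_nested_collections_def nested_families_def)
    moreover have "\<Union>{I. Inl I \<in> M} \<subseteq> X - {i. Inr i \<in> M}"
      using M IB building_setD(3)[OF B] by (fastforce simp: extended_nested_collections_def)
    ultimately show "(X - {i. Inr i \<in> M}, {I. Inl I \<in> M}) \<in> ?\<S>"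
      unfolding nested_families_restrict by auto
  qed
  then show ?thesis
    using finX finF by (subst sum.Sigma) auto
qed

text \<open>The members of \<open>N\<close> that meet \<open>K\<close> cover \<open>K\<close>, so
  their union lies in \<open>B\<close>. By nestedness that union belongs to \<open>N\<close>, and by
  maximality it equals \<open>K\<close>.\<close>

lemma max_elements_restrict_Union:
  assumes B: "building_set X B" and N: "N \<in> nested_families B"
  shows "max_elements (restrict_building B (\<Union>N)) \<subseteq> N"
proof
  fix K assume K: "K \<in> max_elements (restrict_building B (\<Union>N))"
  then have KB: "K \<in> B" "K \<subseteq> \<Union>N"
    by (auto simp: max_elements_def restrict_building_def)
  let ?N' = "{J \<in> N. J \<inter> K \<noteq> {}}"
  have NB: "N \<subseteq> B"
    using N by (simp add: nested_families_def)
  then have "finite N"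
    using building_setD(2)[OF B] finite_subset by blast
  then have "K \<union> \<Union>?N' \<in> B"
    using NB by (intro building_set_Union_meeting[OF B KB(1)]) auto
  moreover have sub: "K \<subseteq> \<Union>?N'"
    using KB(2) by blast
  ultimately have U: "\<Union>?N' \<in> B"
    by (simp add: Un_absorb1)
  then have mem: "\<Union>?N' \<in> N"
    using nested_family_Union_mem[OF B N, of ?N'] by blast
  have "\<Union>?N' = K"
    using K U sub unfolding max_elements_def restrict_building_def by blast
  then show "K \<in> N"
    using mem by simp
qed

text \<open>Adding the maximal elements of \<open>B|\<^sub>S\<close> to a nested collection of \<open>B|\<^sub>S\<close> gives a nested family
  with union \<open>S\<close>, and every nested family arises once in this way.\<close>

lemma sum_nested_families_by_Union:
  fixes g :: "nat \<Rightarrow> nat \<Rightarrow> 'c::comm_monoid_add"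
  assumes B: "building_set X B"
  shows "(\<Sum>N\<in>nested_families B. g (card (\<Union>N)) (card N)) =
    (\<Sum>S\<in>Pow X. \<Sum>N\<in>nested_collections (restrict_building B S).
      g (card S) (card (max_elements (restrict_building B S)) + card N))"
proof -
  have finX: "finite X" and finB: "finite B"
    using building_setD[OF B] by auto
  let ?R = "restrict_building B"
  let ?\<S> = "SIGMA S:Pow X. nested_collections (?R S)"
  have finR: "finite (?R S)" for S
    using finB by (simp add: restrict_building_def)
  have MR: "max_elements (?R S) \<subseteq> ?R S" for S
    by (auto simp: max_elements_def)
  have "(\<Sum>(S, N)\<in>?\<S>. g (card S) (card (max_elements (?R S)) + card N)) =
      (\<Sum>N\<in>nested_families B. g (card (\<Union>N)) (card N))"
  proof (rule sum.reindex_bij_witness[where i = "\<lambda>N. (\<Union>N, N - max_elements (?R (\<Union>N)))"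
        and j = "\<lambda>(S, N). max_elements (?R S) \<union> N"])
    fix SN assume "SN \<in> ?\<S>"
    then obtain S N where SN: "SN = (S, N)" "S \<subseteq> X" "N \<in> nested_collections (?R S)"
      by auto
    have BS: "building_set S (?R S)"
      using building_set_restrict[OF B SN(2)] .
    have N: "N \<subseteq> ?R S - max_elements (?R S)"
      using SN(3) by (simp add: nested_collections_def)
    \<comment> \<open>Singletons make the restriction cover \<open>S\<close>, so \<open>S\<close>
      can be recovered from the enlarged family as its union.\<close>
    have "\<Union>(max_elements (?R S)) = S"
      using Union_max_elements[OF finR, of S] Union_building_set[OF BS] by simp
    then have U: "\<Union>(max_elements (?R S) \<union> N) = S"
      using N by (auto simp: restrict_building_def)
    have "max_elements (?R S) \<union> N - max_elements (?R S) = N"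
      using N by auto
    then show "(\<Union>(case SN of (S, N) \<Rightarrow> max_elements (?R S) \<union> N),
        (case SN of (S, N) \<Rightarrow> max_elements (?R S) \<union> N) -
        max_elements (?R (\<Union>(case SN of (S, N) \<Rightarrow> max_elements (?R S) \<union> N)))) = SN"
      unfolding SN(1) prod.case U by simp
    have "max_elements (?R S) \<union> N \<in> nested_families (?R S)"
      using nested_collection_Un_max[OF BS SN(3) order_refl] by (simp add: Un_commute)
    then show "(case SN of (S, N) \<Rightarrow> max_elements (?R S) \<union> N) \<in> nested_families B"
      using SN(1) by (simp add: nested_families_restrict)
    have "card (max_elements (?R S) \<union> N) = card (max_elements (?R S)) + card N"
      using N MR finR[of S] by (intro card_Un_disjoint) (auto intro: finite_subset)
    then show "g (card (\<Union>(case SN of (S, N) \<Rightarrow> max_elements (?R S) \<union> N)))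
          (card (case SN of (S, N) \<Rightarrow> max_elements (?R S) \<union> N)) =
        (case SN of (S, N) \<Rightarrow> g (card S) (card (max_elements (?R S)) + card N))"
      unfolding SN(1) prod.case U by simp
  next
    fix N assume N: "N \<in> nested_families B"
    show "(case (\<Union>N, N - max_elements (?R (\<Union>N))) of (S, N) \<Rightarrow> max_elements (?R S) \<union> N) = N"
      using max_elements_restrict_Union[OF B N] by auto
    have "N \<in> nested_families (?R (\<Union>N))"
      using N by (simp add: nested_families_restrict)
    then have "N - max_elements (?R (\<Union>N)) \<in> nested_collections (?R (\<Union>N))"
      using nested_family_subset[of "?R (\<Union>N)" N]
      by (auto simp: nested_families_def nested_collections_def)
    moreover have "\<Union>N \<subseteq> X"
      using N building_setD(3)[OF B] by (auto simp: nested_families_def)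
    ultimately show "(\<Union>N, N - max_elements (?R (\<Union>N))) \<in> ?\<S>"
      by simp
  qed
  then show ?thesis
    using finX finite_nested_collections[OF finR] by (subst sum.Sigma) auto
qed

text \<open>Passing to complements \<open>A = X - S\<close> turns the supersets of \<open>U\<close>
  into the subsets of \<open>X - U\<close>. The bound on \<open>k\<close> lets the exponent split
  without truncation.\<close>

lemma sum_supersets_power:
  fixes x :: "'c::comm_semiring_1"
  assumes "finite X" "U \<subseteq> X" "k \<le> card U"
  shows "(\<Sum>S | S \<in> Pow X \<and> U \<subseteq> S. x ^ (card S - k)) =
    (x + 1) ^ (card X - card U) * x ^ (card U - k)"
proof -
  have fin: "finite U" "finite (X - U)"
    using assms finite_subset by auto
  have "(\<Sum>A\<in>Pow (X - U). x ^ (card (X - U) - card A) * x ^ (card U - k)) =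
      (\<Sum>S | S \<in> Pow X \<and> U \<subseteq> S. x ^ (card S - k))"
  proof (rule sum.reindex_bij_witness[where i = "\<lambda>S. X - S" and j = "\<lambda>A. X - A"])
    fix A assume A: "A \<in> Pow (X - U)"
    have "card A \<le> card (X - U)" "card U \<le> card X" "finite A" "A \<subseteq> X"
      using A assms(1,2) fin by (auto intro: card_mono finite_subset)
    then have "card (X - A) - k = (card (X - U) - card A) + (card U - k)"
      using assms(2,3) fin by (simp add: card_Diff_subset)
    then show "x ^ (card (X - A) - k) = x ^ (card (X - U) - card A) * x ^ (card U - k)"
      by (simp add: power_add)
  qed (use assms in auto)
  moreover have "card (X - U) = card X - card U"
    using assms(2) fin(1) by (simp add: card_Diff_subset)
  ultimately show ?thesis
    using sum_Pow_power[OF fin(2), of x] by (simp flip: sum_distrib_right)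
qed

lemma sum_nested_families_restrict:
  fixes x :: "'c::comm_semiring_1"
  assumes B: "building_set X B"
  shows "(\<Sum>S\<in>Pow X. \<Sum>N\<in>nested_families (restrict_building B S). x ^ (card S - card N)) =
    (\<Sum>S\<in>Pow X. (x + 1) ^ (card X - card S) *
      (\<Sum>N\<in>nested_collections (restrict_building B S).
        x ^ (card S - card (max_elements (restrict_building B S)) - card N)))"
proof -
  have finX: "finite X" and finB: "finite B"
    using building_setD[OF B] by auto
  \<comment> \<open>Exchange the sums: a fixed \<open>N\<close> occurs for exactly those
    \<open>S\<close> that contain its union.\<close>
  have "(\<Sum>S\<in>Pow X. \<Sum>N\<in>nested_families (restrict_building B S). x ^ (card S - card N)) =
      (\<Sum>N\<in>nested_families B. \<Sum>S | S \<in> Pow X \<and> \<Union>N \<subseteq> S. x ^ (card S - card N))"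
    unfolding nested_families_restrict
    using finX finite_nested_families[OF finB] by (intro sum.swap_restrict) auto
  also have "\<dots> = (\<Sum>N\<in>nested_families B.
      (x + 1) ^ (card X - card (\<Union>N)) * x ^ (card (\<Union>N) - card N))"
  proof (rule sum.cong[OF refl])
    fix N assume N: "N \<in> nested_families B"
    then have "\<Union>N \<subseteq> X"
      using building_setD(3)[OF B] by (auto simp: nested_families_def)
    then show "(\<Sum>S | S \<in> Pow X \<and> \<Union>N \<subseteq> S. x ^ (card S - card N)) =
        (x + 1) ^ (card X - card (\<Union>N)) * x ^ (card (\<Union>N) - card N)"
      by (rule sum_supersets_power[OF finX _ card_nested_family_le[OF B N]])
  qed
  \<comment> \<open>Each summand now depends on \<open>N\<close> only through the sizes of its union
    and of \<open>N\<close>, so the sum can be regrouped by the union.\<close>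
  finally show ?thesis
    unfolding sum_nested_families_by_Union[OF B, where
        g = "\<lambda>s k. (x + 1) ^ (card X - s) * x ^ (s - k)"]
    by (simp add: sum_distrib_left)
qed

section \<open>The two formulas for the f-polynomial\<close>

theorem theorem5p4:
  fixes n :: nat
    and B :: "nat set set"
    and Pext :: "'a::euclidean_space set"
    and P :: "nat set \<Rightarrow> 'b::euclidean_space set"
  assumes "building_set {1..n} B"
    and "extended_nestohedron {1..n} B Pext"
    and "\<And>S. S \<subseteq> {1..n} \<Longrightarrow> nestohedron S (restrict_building B S) (P S)"
  shows "f_poly Pext = (\<Sum>S\<in>Pow {1..n}. [:1, 1:] ^ (n - card S) * f_poly (P S)) \<and>
         f_poly Pext =
           (\<Sum>S\<in>Pow {1..n}. [:1, 1:] ^ card (max_elements (restrict_building B S)) * f_poly (P S))"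
proof -
  let ?R = "restrict_building B"
  have B: "building_set {1..n} B"
    using assms(1) .
  have ext: "f_poly Pext =
      (\<Sum>M\<in>extended_nested_collections {1..n} B. [:0, 1:] ^ (card {1..n} - card M))"
    using assms(2) f_poly_dual_simplicial unfolding extended_nestohedron_def
    by (metis nat_int)
  have nest: "(\<Sum>N\<in>nested_collections (?R S).
      [:0, 1:] ^ (card S - card (max_elements (?R S)) - card N)) = f_poly (P S)"
    if "S \<in> Pow {1..n}" for S
  proof -
    have "nestohedron S (?R S) (P S)"
      using assms(3) that by simp
    then obtain Q :: "'b set" where Q: "simplicial_polytope Q" "dual_polytopes (P S) Q"
        "complex_isomorphic (nested_collections (?R S)) (boundary_complex Q)"
      and dim: "aff_dim (P S) = int (card S) - int (card (max_elements (?R S)))"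
      unfolding nestohedron_def by blast
    have "nat (aff_dim (P S)) = card S - card (max_elements (?R S))"
      using dim by linarith
    then show ?thesis
      using f_poly_dual_simplicial[OF Q] by simp
  qed
  \<comment> \<open>\<open>[:0, 1:]\<close> is the variable t, so this identifies the factor
    produced by the generating functions with t + 1.\<close>
  have x1: "[:0, 1::int:] + 1 = [:1, 1:]"
    by (simp add: one_pCons)
  have "f_poly Pext = (\<Sum>S\<in>Pow {1..n}. [:1, 1:] ^ (n - card S) * f_poly (P S))"
    unfolding ext sum_extended_nested_collections[OF B] sum_nested_families_restrict[OF B] x1
    by (intro sum.cong refl) (simp only: nest card_atLeastAtMost diff_Suc_1)
  moreover have "f_poly Pext =
      (\<Sum>S\<in>Pow {1..n}. [:1, 1:] ^ card (max_elements (?R S)) * f_poly (P S))"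
    unfolding ext sum_extended_nested_collections[OF B]
  proof (rule sum.cong[OF refl])
    fix S assume S: "S \<in> Pow {1..n}"
    then have "building_set S (?R S)"
      using building_set_restrict[OF B] by simp
    from sum_nested_families[OF this, of "[:0, 1::int:]"]
    show "(\<Sum>N\<in>nested_families (?R S). [:0, 1:] ^ (card S - card N)) =
        [:1, 1:] ^ card (max_elements (?R S)) * f_poly (P S)"
      unfolding x1 nest[OF S] .
  qed
  ultimately show ?thesis ..
qed

end
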